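(* Let $\chi:\mathbb{R}\to\mathbb{R}$ be a kernel which satisfies $m_0(\chi,u)=1$ and $m_1(\chi,u)=0$ for every $u\in\mathbb{R}$. Let $f\in C^{(2)}(\mathbb{R})$ and suppose that $$\|S_w f-f\|_\infty=o(w^{-1})\quad\text{as } w\to+\infty,$$ where $$(S_w f)(x):=\sum_{k\in\mathbb{Z}}\chi(wx-k)\left[w\int_{k/w}^{(k+1)/w}f(u)\,du\right],\qquad x\in\mathbb{R},\ w>0.$$ Then $f$ is constant on $\mathbb{R}$.
   Context: $C(\mathbb{R})$ denotes the space of all uniformly continuous and bounded functions $f:\mathbb{R}\to\mathbb{R}$, with the norm $\|f\|_\infty=\sup_{x\in\mathbb{R}}|f(x)|$. For a positive integer $r$, $C^{(r)}(\mathbb{R})$ is the subspace of those $f\in C(\mathbb{R})$ whose derivatives $f^{(s)}$ exist and belong to $C(\mathbb{R})$ for every $1\le s\le r$. For $g:\mathbb{R}\to\mathbb{R}$, the discrete moment of order $\beta\in\{0,1,2,\dots\}$ at $u\in\mathbb{R}$ is $m_\beta(g,u):=\sum_{k\in\mathbb{Z}}g(u-k)(u-k)^\beta$, and the discrete absolute moment of order $\beta\ge 0$ is $M_\beta(g):=\sup_{u\in\mathbb{R}}\sum_{k\in\mathbb{Z}}|g(u-k)|\,|u-k|^\beta$. A condition prescribing the value of a discrete moment includes that the series defining it converges (absolutely). A kernel is a function $\chi:\mathbb{R}\to\mathbb{R}$ such that: (1) $\chi\in L^1(\mathbb{R})$ and $\chi$ is bounded in a neighbourhood of the origin; (2) $\sum_{k\in\mathbb{Z}}\chi(u-k)=1$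 for every $u\in\mathbb{R}$; (3) there exists $\beta>0$ for which $M_\beta(\chi)<+\infty$. *)

theory Defs
  imports "HOL-Analysis.Analysis" "HOL-Library.Landau_Symbols"
begin

definition ub_continuous :: "(real \<Rightarrow> real) set" where
  "ub_continuous = {f. uniformly_continuous_on UNIV f \<and> bounded (range f)}"

definition ub_continuous_deriv :: "nat \<Rightarrow> (real \<Rightarrow> real) set" where
  "ub_continuous_deriv r = {f \<in> ub_continuous. \<forall>s. 1 \<le> s \<and> s \<le> r \<longrightarrow>
     (\<forall>x. (deriv ^^ (s - 1)) f field_differentiable at x) \<and> (deriv ^^ s) f \<in> ub_continuous}"

text \<open>Real-valued, hence the norm only for bounded \<open>g\<close>; for unbounded \<open>g\<close> the value is
  unspecified. It is used below for \<open>S\<^sub>w f - f\<close>, which is bounded for every kernel and every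
  bounded continuous \<open>f\<close>, since \<open>M\<^sub>\<beta>(\<phi>) < \<infinity>\<close> for some \<open>\<beta> > 0\<close> and local boundedness of \<open>\<phi>\<close> at
  the origin give \<open>M\<^sub>0(\<phi>) < \<infinity>\<close>.\<close>
definition sup_norm :: "(real \<Rightarrow> real) \<Rightarrow> real" where
  "sup_norm g = (SUP x. \<bar>g x\<bar>)"

text \<open>\<open>m\<^sub>\<beta>(g, u)\<close> exists and equals \<open>m\<close>. For real-valued families \<open>has_sum\<close> amounts to absolute
  convergence with the given sum.\<close>
definition has_discrete_moment :: "(real \<Rightarrow> real) \<Rightarrow> nat \<Rightarrow> real \<Rightarrow> real \<Rightarrow> bool" where
  "has_discrete_moment g \<beta> u m \<longleftrightarrow>
     ((\<lambda>k::int. g (u - of_int k) * (u - of_int k) ^ \<beta>) has_sum m) UNIV"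

text \<open>The case distinction encodes \<open>0\<^sup>0 = 1\<close>, whereas \<open>0 powr 0 = 0\<close>.\<close>
definition abs_moment :: "real \<Rightarrow> (real \<Rightarrow> real) \<Rightarrow> ennreal" where
  "abs_moment \<beta> g = (SUP u. \<Sum>\<^sub>\<infinity>k::int.
     ennreal (\<bar>g (u - of_int k)\<bar> * (if \<beta> = 0 then 1 else \<bar>u - of_int k\<bar> powr \<beta>)))"

definition sampling_kernel :: "(real \<Rightarrow> real) \<Rightarrow> bool" where
  "sampling_kernel \<phi> \<longleftrightarrow>
     integrable lebesgue \<phi> \<and> (\<exists>\<delta>>0. bounded (\<phi> ` ball 0 \<delta>)) \<and>
     (\<forall>u. ((\<lambda>k::int. \<phi> (u - of_int k)) has_sum 1) UNIV) \<and>
     (\<exists>\<beta>>0. abs_moment \<beta> \<phi> < \<infinity>)"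

definition sampling_op :: "(real \<Rightarrow> real) \<Rightarrow> real \<Rightarrow> (real \<Rightarrow> real) \<Rightarrow> real \<Rightarrow> real" where
  "sampling_op \<phi> w f x = (\<Sum>\<^sub>\<infinity>k::int.
     \<phi> (w * x - of_int k) * (w * integral {of_int k / w .. (of_int k + 1) / w} f))"

end

theory Submission
  imports Defs
begin

text \<open>Fix \<open>x \<noteq> 0\<close> and let \<open>w\<close> run through the multiples of \<open>1 / \<bar>x\<bar>\<close>. Then \<open>w x\<close> is an integer, so after
  a shift of the summation index only the values of \<open>\<phi>\<close> on the integers enter \<open>S\<^sub>w f x\<close>. Since \<open>f\<close> is
  Lipschitz, the terms of \<open>w (S\<^sub>w f x - f x)\<close> are dominated by a multiple of \<open>\<bar>\<phi>(-k)\<bar> (\<bar>k\<bar> + 1)\<close>, which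
  is summable because the moments at \<open>0\<close> converge absolutely; no bound on the first absolute moment
  that is uniform in \<open>u\<close> is available. The mean of \<open>f\<close> over \<open>[x + k/w, x + (k+1)/w]\<close> is
  \<open>f x + f' x (k + 1/2) / w + o(1/w)\<close>, so dominated convergence gives the limit \<open>f' x / 2\<close>, which the
  assumed rate forces to be \<open>0\<close>.\<close>

section \<open>Dominated convergence for unordered sums\<close>

text \<open>A summable family is an integrable function for the counting measure, so this is
  Lebesgue's theorem there, carried back to \<open>infsum\<close>.\<close>

lemma infsum_dominated_convergence:
  fixes F :: "nat \<Rightarrow> 'a \<Rightarrow> real"
  assumes g: "g summable_on A"
    and bound: "\<And>n k. k \<in> A \<Longrightarrow> \<bar>F n k\<bar> \<le> g k"
    and lim: "\<And>k. k \<in> A \<Longrightarrow> (\<lambda>n. F n k) \<longlonglongrightarrow> G k"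
  shows "(\<lambda>n. infsum (F n) A) \<longlonglongrightarrow> infsum G A"
proof -
  have g': "integrable (count_space A) g"
    using g summable_on_iff_abs_summable_on_real abs_summable_equivalent
    by (fastforce simp: abs_summable_on_def)
  have conv: "(\<lambda>n. integral\<^sup>L (count_space A) (F n)) \<longlonglongrightarrow> integral\<^sup>L (count_space A) G"
    by (rule integral_dominated_convergence[OF _ _ g'])
       (use bound lim in \<open>auto simp: AE_count_space\<close>)
  \<comment> \<open>The limit inherits the majorant, so \<open>G\<close> too is absolutely summable
    and its Bochner integral equals its \<open>infsum\<close>.\<close>
  have Gb: "\<bar>G k\<bar> \<le> g k" if "k \<in> A" for k
    by (rule LIMSEQ_le_const2[OF tendsto_rabs[OF lim[OF that]]]) (use bound that in auto)
  have eq: "integral\<^sup>L (count_space A) H = infsum H A" if "\<And>k. k \<in> A \<Longrightarrow> \<bar>H k\<bar> \<le> g k" for H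
  proof -
    have "Infinite_Set_Sum.abs_summable_on H A"
      unfolding abs_summable_on_def
      by (rule Bochner_Integration.integrable_bound[OF g'])
         (use that in \<open>force simp: AE_count_space\<close>)+
    then show ?thesis
      using infsetsum_infsum unfolding infsetsum_def by blast
  qed
  show ?thesis
    using conv eq[OF bound] eq[OF Gb] by simp
qed

section \<open>Means over intervals of length \<open>1 / w\<close>\<close>

lemma interval_average_bound:
  fixes g :: "real \<Rightarrow> real"
  assumes "w > 0" "continuous_on UNIV g"
    and "\<And>t. a \<le> t \<Longrightarrow> t \<le> a + 1 / w \<Longrightarrow> \<bar>g t\<bar> \<le> B"
  shows "\<bar>w * integral {a..a + 1 / w} g\<bar> \<le> B"
proof -
  have "norm (integral {a..a + 1 / w} g) \<le> B * (a + 1 / w - a)"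
    by (rule integral_bound) (use assms in \<open>auto intro: continuous_on_subset\<close>)
  then show ?thesis
    using assms(1) by (simp add: abs_mult field_simps)
qed

text \<open>The mean of an affine function is its value at the midpoint, here
  \<open>x + (c + 1 / 2) / w\<close>. The case where \<open>d\<close> is the derivative serves the
  expansion, the case \<open>d = 0\<close> the Lipschitz bound.\<close>

lemma interval_average_affine:
  fixes f :: "real \<Rightarrow> real"
  assumes "w > 0" "continuous_on UNIV f"
  shows "w * integral {x + c / w..x + c / w + 1 / w} (\<lambda>t. f t - (p + d * (t - x)))
    = w * integral {x + c / w..x + c / w + 1 / w} f - p - d * (c + 1 / 2) / w"
proof -
  let ?a = "x + c / w" and ?b = "x + c / w + 1 / w"
  have "((\<lambda>t. p + d * (t - x)) has_integral
      (p * ?b + d * (?b - x)\<^sup>2 / 2) - (p * ?a + d * (?a - x)\<^sup>2 / 2)) {?a..?b}"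
    using assms(1)
    by (intro fundamental_theorem_of_calculus)
       (auto intro!: derivative_eq_intros simp flip: has_real_derivative_iff_has_vector_derivative)
  moreover have "f integrable_on {?a..?b}"
    using assms(2) by (intro integrable_continuous_interval) (auto intro: continuous_on_subset)
  ultimately have "integral {?a..?b} (\<lambda>t. f t - (p + d * (t - x)))
    = integral {?a..?b} f - ((p * ?b + d * (?b - x)\<^sup>2 / 2) - (p * ?a + d * (?a - x)\<^sup>2 / 2))"
    by (simp add: integral_diff has_integral_integrable integral_unique)
  moreover have "w * ((p * ?b + d * (?b - x)\<^sup>2 / 2) - (p * ?a + d * (?a - x)\<^sup>2 / 2))
    = p + d * (c + 1 / 2) / w"
    using assms(1) by (simp add: field_simps power2_eq_square)
  ultimately show ?thesis
    by (simp add: right_diff_distrib)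
qed

text \<open>The interval lies within \<open>(\<bar>c\<bar> + 1) / w n\<close> of \<open>x\<close>,
  so differentiability at the single point \<open>x\<close> makes the mean of the remainder
  \<open>o(1 / w n)\<close>, which survives multiplication by \<open>w n\<close>.\<close>

lemma interval_average_expansion:
  fixes f :: "real \<Rightarrow> real" and w :: "nat \<Rightarrow> real"
  assumes f: "continuous_on UNIV f" and f': "(f has_real_derivative d) (at x)"
    and w: "\<And>n. w n > 0" "filterlim w at_top sequentially"
  shows "(\<lambda>n. w n * (w n * integral {x + c / w n..x + c / w n + 1 / w n} f - f x))
    \<longlonglongrightarrow> d * (c + 1 / 2)"
proof (rule LIMSEQ_I)
  fix r :: real
  assume r: "r > 0"
  \<comment> \<open>Chosen so that \<open>e * (\<bar>c\<bar> + 1) = r / 2\<close>, which leaves the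
    final estimate strictly below \<open>r\<close>.\<close>
  define e where "e = r / (2 * (\<bar>c\<bar> + 1))"
  have e: "e > 0" using r by (simp add: e_def add_nonneg_pos)
  obtain \<delta> where \<delta>: "\<delta> > 0"
    "\<And>t. \<bar>t - x\<bar> < \<delta> \<Longrightarrow> \<bar>f t - f x - d * (t - x)\<bar> \<le> e * \<bar>t - x\<bar>"
    using f' e unfolding has_field_derivative_def has_derivative_at_alt by (auto simp: mult.commute)
  have "\<forall>\<^sub>F n in sequentially. w n > (\<bar>c\<bar> + 1) / \<delta>"
    using w(2) by (simp add: filterlim_at_top_dense)
  then obtain N where N: "\<And>n. n \<ge> N \<Longrightarrow> w n > (\<bar>c\<bar> + 1) / \<delta>"
    by (auto simp: eventually_sequentially)
  have "norm (w n * (w n * integral {x + c / w n..x + c / w n + 1 / w n} f - f x)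
      - d * (c + 1 / 2)) < r" if n: "n \<ge> N" for n
  proof -
    let ?w = "w n" and ?I = "{x + c / w n..x + c / w n + 1 / w n}"
    have wp: "?w > 0" by (rule w)
    have small: "(\<bar>c\<bar> + 1) / ?w < \<delta>"
      using N[OF n] \<delta>(1) wp by (simp add: field_simps)
    have "\<bar>?w * integral ?I (\<lambda>t. f t - (f x + d * (t - x)))\<bar> \<le> e * ((\<bar>c\<bar> + 1) / ?w)"
    proof (rule interval_average_bound[OF wp])
      fix t assume t: "x + c / ?w \<le> t" "t \<le> x + c / ?w + 1 / ?w"
      \<comment> \<open>In fact \<open>(t - x) * ?w\<close> lies between \<open>c\<close> and
        \<open>c + 1\<close>.\<close>
      have "\<bar>(t - x) * ?w\<bar> \<le> \<bar>c\<bar> + 1"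
        using t wp by (auto simp: field_simps abs_le_iff)
      then have tb: "\<bar>t - x\<bar> \<le> (\<bar>c\<bar> + 1) / ?w"
        using wp by (simp add: abs_mult pos_le_divide_eq)
      have "\<bar>f t - f x - d * (t - x)\<bar> \<le> e * \<bar>t - x\<bar>"
        using tb small by (intro \<delta>(2)) simp
      also have "\<dots> \<le> e * ((\<bar>c\<bar> + 1) / ?w)"
        using tb e by (intro mult_left_mono) auto
      finally show "\<bar>f t - (f x + d * (t - x))\<bar> \<le> e * ((\<bar>c\<bar> + 1) / ?w)"
        by (simp add: algebra_simps)
    qed (intro continuous_intros f)
    moreover have "e * (\<bar>c\<bar> + 1) = r / 2"
      using abs_ge_zero[of c] by (simp add: e_def divide_simps)
    ultimately have "\<bar>?w * integral ?I f - f x - d * (c + 1 / 2) / ?w\<bar> \<le> r / 2 / ?w"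
      unfolding interval_average_affine[OF wp f] by (simp only: times_divide_eq_right)
    then have "?w * \<bar>?w * integral ?I f - f x - d * (c + 1 / 2) / ?w\<bar> \<le> r / 2"
      using wp by (simp add: field_simps)
    then have "\<bar>?w * (?w * integral ?I f - f x - d * (c + 1 / 2) / ?w)\<bar> \<le> r / 2"
      using wp by (simp only: abs_mult abs_of_pos)
    moreover have "?w * (?w * integral ?I f - f x - d * (c + 1 / 2) / ?w)
        = ?w * (?w * integral ?I f - f x) - d * (c + 1 / 2)"
      using wp by (simp add: right_diff_distrib)
    ultimately show ?thesis using r by simp
  qed
  then show "\<exists>N. \<forall>n\<ge>N. norm (w n * (w n * integral {x + c / w n..x + c / w n + 1 / w n} f - f x)
      - d * (c + 1 / 2)) < r" by blast
qed

text \<open>The bound is free of \<open>w\<close> and grows only linearly in \<open>c\<close>; this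
  makes it a majorant that absolute convergence of the moments of order 0 and 1 renders
  summable.\<close>

lemma interval_average_lipschitz_bound:
  fixes f :: "real \<Rightarrow> real"
  assumes "w > 0" "continuous_on UNIV f" and L: "\<And>s t. \<bar>f s - f t\<bar> \<le> L * \<bar>s - t\<bar>"
  shows "\<bar>w * (w * integral {x + c / w..x + c / w + 1 / w} f - f x)\<bar> \<le> L * (\<bar>c\<bar> + 1)"
proof -
  have L0: "L \<ge> 0" using L[of 1 0] by simp
  \<comment> \<open>The term \<open>0 * (t - x)\<close> is kept so that
    \<open>interval_average_affine\<close> applies with \<open>d = 0\<close>.\<close>
  have "\<bar>w * integral {x + c / w..x + c / w + 1 / w} (\<lambda>t. f t - (f x + 0 * (t - x)))\<bar>
      \<le> L * ((\<bar>c\<bar> + 1) / w)"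
  proof (rule interval_average_bound[OF assms(1)])
    fix t assume t: "x + c / w \<le> t" "t \<le> x + c / w + 1 / w"
    have "\<bar>(t - x) * w\<bar> \<le> \<bar>c\<bar> + 1"
      using t assms(1) by (auto simp: field_simps abs_le_iff)
    then have tb: "\<bar>t - x\<bar> \<le> (\<bar>c\<bar> + 1) / w"
      using assms(1) by (simp add: abs_mult pos_le_divide_eq)
    show "\<bar>f t - (f x + 0 * (t - x))\<bar> \<le> L * ((\<bar>c\<bar> + 1) / w)"
      using L[of t x] mult_left_mono[OF tb L0] by simp
  qed (intro continuous_intros assms)
  then have "w * \<bar>w * integral {x + c / w..x + c / w + 1 / w} f - f x\<bar> \<le> L * (\<bar>c\<bar> + 1)"
    unfolding interval_average_affine[OF assms(1,2)] using assms(1) by (simp add: field_simps)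
  then show ?thesis
    using assms(1) by (simp add: abs_mult)
qed

section \<open>Boundedness of the sampling operator and the supremum norm\<close>

text \<open>Terms with \<open>\<bar>u - k\<bar> \<ge> \<delta>\<close> are controlled by the moment
  of order \<open>\<beta>\<close> divided by \<open>\<delta> powr \<beta>\<close>; the remaining
  ones by the bound near the origin.\<close>

lemma sampling_kernel_abs_sum_bounded:
  assumes "sampling_kernel \<phi>"
  obtains K where "\<And>u. (\<Sum>\<^sub>\<infinity>k::int. \<bar>\<phi> (u - of_int k)\<bar>) \<le> K"
proof -
  obtain \<delta>' where \<delta>': "\<delta>' > 0" "bounded (\<phi> ` ball 0 \<delta>')"
    using assms by (auto simp: sampling_kernel_def)
  then obtain B where B: "\<And>v. \<bar>v\<bar> < \<delta>' \<Longrightarrow> \<bar>\<phi> v\<bar> \<le> B"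
    unfolding bounded_iff by (metis (no_types, lifting) dist_0_norm image_eqI mem_ball real_norm_def)
  \<comment> \<open>Distinct integers are at least 1 apart, so with
    \<open>\<delta> \<le> 1/2\<close> at most one of them is closer than \<open>\<delta>\<close> to
    \<open>u\<close>.\<close>
  define \<delta> where "\<delta> = min \<delta>' (1/2)"
  have \<delta>: "\<delta> > 0" "\<delta> \<le> 1/2" "\<delta> \<le> \<delta>'" using \<delta>' by (auto simp: \<delta>_def)
  obtain \<beta> where \<beta>: "\<beta> > 0" "abs_moment \<beta> \<phi> < \<infinity>"
    using assms by (auto simp: sampling_kernel_def)
  define C where "C = enn2real (abs_moment \<beta> \<phi>)"
  have moment: "(\<Sum>k\<in>F. \<bar>\<phi> (u - of_int k)\<bar> * \<bar>u - of_int k\<bar> powr \<beta>) \<le> C" if "finite F"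
    for u and F :: "int set"
  proof -
    let ?t = "\<lambda>k::int. \<bar>\<phi> (u - of_int k)\<bar> * \<bar>u - of_int k\<bar> powr \<beta>"
    have "ennreal (\<Sum>k\<in>F. ?t k) = (\<Sum>k\<in>F. ennreal (?t k))"
      by (simp add: sum_ennreal)
    also have "\<dots> \<le> (\<Sum>\<^sub>\<infinity>k. ennreal (?t k))"
      unfolding infsum_finite[OF that, symmetric]
      by (rule infsum_mono_neutral) (auto intro: nonneg_summable_on_complete)
    also have "\<dots> \<le> abs_moment \<beta> \<phi>"
      unfolding abs_moment_def using \<beta> by (intro SUP_upper2[of u]) auto
    also have "\<dots> = ennreal C"
      using \<beta> by (simp add: C_def)
    finally show ?thesis
      by (simp add: C_def)
  qed
  have part: "(\<Sum>k\<in>F. \<bar>\<phi> (u - of_int k)\<bar>) \<le> C / \<delta> powr \<beta> + B" if F: "finite F"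
    for u and F :: "int set"
  proof -
    let ?near = "F \<inter> {k. \<bar>u - of_int k\<bar> < \<delta>}" and ?far = "F - {k. \<bar>u - of_int k\<bar> < \<delta>}"
    have B0: "B \<ge> 0" using B[of 0] \<delta>' by auto
    have "(\<Sum>k\<in>?far. \<bar>\<phi> (u - of_int k)\<bar>)
        \<le> (\<Sum>k\<in>?far. \<bar>\<phi> (u - of_int k)\<bar> * \<bar>u - of_int k\<bar> powr \<beta> / \<delta> powr \<beta>)"
    proof (rule sum_mono)
      fix k assume "k \<in> ?far"
      then have "\<delta> powr \<beta> \<le> \<bar>u - of_int k\<bar> powr \<beta>"
        using \<delta> \<beta> by (intro powr_mono2) auto
      then show "\<bar>\<phi> (u - of_int k)\<bar>
          \<le> \<bar>\<phi> (u - of_int k)\<bar> * \<bar>u - of_int k\<bar> powr \<beta> / \<delta> powr \<beta>"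
        using \<delta> by (simp add: le_divide_eq mult_left_mono)
    qed
    also have "\<dots> \<le> C / \<delta> powr \<beta>"
      unfolding sum_divide_distrib[symmetric]
      using moment[of ?far u] F by (intro divide_right_mono) auto
    finally have far: "(\<Sum>k\<in>?far. \<bar>\<phi> (u - of_int k)\<bar>) \<le> C / \<delta> powr \<beta>" .
    have one: "card ?near \<le> 1"
      using F \<delta> by (auto simp: card_le_Suc0_iff_eq)
    have "(\<Sum>k\<in>?near. \<bar>\<phi> (u - of_int k)\<bar>) \<le> of_nat (card ?near) * B"
      using B \<delta> by (intro sum_bounded_above) auto
    also have "\<dots> \<le> 1 * B"
      using one B0 by (intro mult_right_mono) auto
    finally show ?thesis
      using far sum.Int_Diff[OF F, of "\<lambda>k. \<bar>\<phi> (u - of_int k)\<bar>" "{k. \<bar>u - of_int k\<bar> < \<delta>}"]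
      by simp
  qed
  show ?thesis
  proof (rule that)
    fix u
    \<comment> \<open>Summability for each \<open>u\<close> comes from the partition of unity; the
      finite sums above supply the uniformity in \<open>u\<close>.\<close>
    have "(\<lambda>k::int. \<phi> (u - of_int k)) summable_on UNIV"
      using assms by (auto simp: sampling_kernel_def summable_on_def)
    then have "(\<lambda>k::int. \<bar>\<phi> (u - of_int k)\<bar>) summable_on UNIV"
      using summable_on_iff_abs_summable_on_real by fastforce
    then show "(\<Sum>\<^sub>\<infinity>k::int. \<bar>\<phi> (u - of_int k)\<bar>) \<le> C / \<delta> powr \<beta> + B"
      by (rule infsum_le_finite_sums) (use part in auto)
  qed
qed

text \<open>The means of \<open>f\<close> obey the same bound as \<open>f\<close>, and the kernel
  contributes a factor uniform in \<open>x\<close>. This makes \<open>sup_norm\<close> of the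
  approximation error meaningful.\<close>

lemma bounded_sampling_op:
  assumes \<phi>: "sampling_kernel \<phi>" and w: "w > 0"
    and f: "continuous_on UNIV f" "bounded (range f)"
  shows "bounded (range (sampling_op \<phi> w f))"
proof -
  obtain K where K: "\<And>u. (\<Sum>\<^sub>\<infinity>k::int. \<bar>\<phi> (u - of_int k)\<bar>) \<le> K"
    using sampling_kernel_abs_sum_bounded[OF \<phi>] by blast
  obtain B where B: "\<And>t. \<bar>f t\<bar> \<le> B"
    using f(2) by (auto simp: bounded_iff)
  have B0: "B \<ge> 0" using B[of 0] by simp
  have "\<bar>sampling_op \<phi> w f x\<bar> \<le> K * B" for x
  proof -
    let ?A = "\<lambda>k::int. w * integral {of_int k / w..(of_int k + 1) / w} f"
    let ?t = "\<lambda>k::int. \<phi> (w * x - of_int k) * ?A k"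
    have A: "\<bar>?A k\<bar> \<le> B" for k
      using interval_average_bound[OF w f(1), of "of_int k / w" B] B
      by (simp add: add_divide_distrib)
    have le: "norm (?t k) \<le> \<bar>\<phi> (w * x - of_int k)\<bar> * B" for k
      using A[of k] by (simp only: real_norm_def abs_mult) (simp add: mult_left_mono)
    have "(\<lambda>k::int. \<phi> (w * x - of_int k)) summable_on UNIV"
      using \<phi> by (auto simp: sampling_kernel_def summable_on_def)
    then have s: "(\<lambda>k::int. \<bar>\<phi> (w * x - of_int k)\<bar>) summable_on UNIV"
      using summable_on_iff_abs_summable_on_real by fastforce
    then have s': "(\<lambda>k::int. \<bar>\<phi> (w * x - of_int k)\<bar> * B) summable_on UNIV"
      by (rule summable_on_cmult_left)
    then have t: "(\<lambda>k. norm (?t k)) summable_on UNIV"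
      by (rule Infinite_Sum.abs_summable_on_comparison_test') (use le in auto)
    have "\<bar>sampling_op \<phi> w f x\<bar> \<le> (\<Sum>\<^sub>\<infinity>k. norm (?t k))"
      unfolding sampling_op_def using norm_infsum_bound[OF t] by simp
    also have "\<dots> \<le> (\<Sum>\<^sub>\<infinity>k::int. \<bar>\<phi> (w * x - of_int k)\<bar> * B)"
      by (rule infsum_mono[OF t s' le])
    also have "\<dots> = (\<Sum>\<^sub>\<infinity>k::int. \<bar>\<phi> (w * x - of_int k)\<bar>) * B"
      by (rule infsum_cmult_left) (use s in simp)
    also have "\<dots> \<le> K * B"
      using K B0 by (intro mult_right_mono) auto
    finally show ?thesis .
  qed
  then show ?thesis by (auto simp: bounded_iff)
qed

lemma abs_le_sup_norm:
  assumes "bounded (range g)"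
  shows "\<bar>g x\<bar> \<le> sup_norm g"
proof -
  have "bdd_above (range (\<lambda>x. \<bar>g x\<bar>))"
    using assms by (auto simp: bounded_iff bdd_above_def)
  then show ?thesis
    unfolding sup_norm_def by (rule cSUP_upper[OF UNIV_I])
qed

section \<open>Asymptotics where \<open>w * x\<close> is an integer\<close>

text \<open>Replacing \<open>k\<close> by \<open>m + k\<close> turns the kernel argument into
  \<open>-k\<close>, which depends on neither \<open>w\<close> nor \<open>x\<close>.\<close>

lemma sampling_op_at_node:
  assumes "w > 0" "w * x = of_int m"
  shows "sampling_op \<phi> w f x = (\<Sum>\<^sub>\<infinity>k::int. \<phi> (- of_int k) *
    (w * integral {x + of_int k / w..x + of_int k / w + 1 / w} f))"
proof -
  have x: "x = of_int m / w" using assms by (simp add: field_simps)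
  have "bij (\<lambda>k::int. m + k)"
    by (rule bijI'[of "\<lambda>k. m + k"]) (auto intro: exI[of _ "_ - m"])
  from infsum_reindex_bij_betw[OF this, symmetric,
      of "\<lambda>k. \<phi> (w * x - of_int k) * (w * integral {of_int k / w .. (of_int k + 1) / w} f)"]
  show ?thesis
    unfolding sampling_op_def assms(2) by (simp add: x add_divide_distrib)
qed

lemma sampling_op_voronovskaya:
  fixes w :: "nat \<Rightarrow> real"
  assumes m0: "has_discrete_moment \<phi> 0 0 1" and m1: "has_discrete_moment \<phi> 1 0 0"
    and f: "continuous_on UNIV f" "\<And>s t. \<bar>f s - f t\<bar> \<le> L * \<bar>s - t\<bar>"
    and f': "(f has_real_derivative d) (at x)"
    and w: "\<And>n. w n > 0" "filterlim w at_top sequentially" "\<And>n. w n * x \<in> \<int>"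
  shows "(\<lambda>n. w n * (sampling_op \<phi> (w n) f x - f x)) \<longlonglongrightarrow> d / 2"
proof -
  let ?A = "\<lambda>n k::int. w n * (w n * integral {x + of_int k / w n..x + of_int k / w n + 1 / w n} f - f x)"
  let ?F = "\<lambda>n k::int. \<phi> (- of_int k) * ?A n k"
  let ?g = "\<lambda>k::int. \<bar>\<phi> (- of_int k)\<bar> * (L * (\<bar>of_int k\<bar> + 1))"
  have s0: "((\<lambda>k::int. \<phi> (- of_int k)) has_sum 1) UNIV"
    using m0 by (simp add: has_discrete_moment_def)
  \<comment> \<open>The moment at \<open>u = 0\<close> has the factor \<open>-k\<close>; negating
    the sum gives the factor \<open>k\<close>.\<close>
  have s1: "((\<lambda>k::int. \<phi> (- of_int k) * of_int k) has_sum 0) UNIV"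
    using has_sum_uminusI[OF m1[unfolded has_discrete_moment_def]] by simp
  have "(\<lambda>k::int. \<bar>\<phi> (- of_int k)\<bar>) summable_on UNIV"
    "(\<lambda>k::int. \<bar>\<phi> (- of_int k) * of_int k\<bar>) summable_on UNIV"
    using s0 s1 summable_on_iff_abs_summable_on_real unfolding summable_on_def by fastforce+
  from summable_on_cmult_right[OF summable_on_add[OF this], of L]
  have g: "?g summable_on UNIV"
    by (simp add: abs_mult algebra_simps)
  have bound: "\<bar>?F n k\<bar> \<le> ?g k" for n k
    using interval_average_lipschitz_bound[OF w(1) f]
    by (subst abs_mult) (intro mult_left_mono, auto)
  have "(\<lambda>n. infsum (?F n) UNIV) \<longlonglongrightarrow>
      (\<Sum>\<^sub>\<infinity>k::int. \<phi> (- of_int k) * (d * (of_int k + 1 / 2)))"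
    by (rule infsum_dominated_convergence[OF g bound])
       (intro tendsto_mult_left interval_average_expansion f f' w)
  \<comment> \<open>The first moment cancels the part linear in \<open>k\<close>. The limit
    \<open>d / 2\<close> comes from the midpoint shift \<open>1 / 2\<close> and the zeroth
    moment.\<close>
  moreover have "((\<lambda>k::int. d * (\<phi> (- of_int k) * of_int k) + d / 2 * \<phi> (- of_int k))
      has_sum d * 0 + d / 2 * 1) UNIV"
    by (intro has_sum_add has_sum_cmult_right s0 s1)
  then have "(\<Sum>\<^sub>\<infinity>k::int. \<phi> (- of_int k) * (d * (of_int k + 1 / 2))) = d / 2"
    by (intro infsumI) (simp add: algebra_simps)
  moreover have "infsum (?F n) UNIV = w n * (sampling_op \<phi> (w n) f x - f x)" for n
  proof -
    let ?I = "\<lambda>k::int. w n * integral {x + of_int k / w n..x + of_int k / w n + 1 / w n} f"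
    obtain m where m: "w n * x = of_int m" using w(3) by (auto elim: Ints_cases)
    have "?F n summable_on UNIV"
      using Infinite_Sum.abs_summable_on_comparison_test'[OF g, of "?F n"] bound
        summable_on_iff_abs_summable_on_real by auto
    then have F: "(?F n has_sum infsum (?F n) UNIV) UNIV" by simp
    \<comment> \<open>Since the values \<open>\<phi> (-k)\<close> sum to 1, subtracting
      \<open>f x\<close> from the operator amounts to subtracting it from every mean.\<close>
    have "((\<lambda>k. (1 / w n) * ?F n k + f x * \<phi> (- of_int k)) has_sum
        (1 / w n) * infsum (?F n) UNIV + f x * 1) UNIV"
      by (intro has_sum_add has_sum_cmult_right s0 F)
    moreover have "(1 / w n) * ?F n k + f x * \<phi> (- of_int k) = \<phi> (- of_int k) * ?I k" for k
      using w(1)[of n] by (simp add: algebra_simps)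
    ultimately have "sampling_op \<phi> (w n) f x = (1 / w n) * infsum (?F n) UNIV + f x * 1"
      unfolding sampling_op_at_node[OF w(1) m] by (intro infsumI) simp
    then show ?thesis using w(1)[of n] by simp
  qed
  ultimately show ?thesis by simp
qed

section \<open>From the approximation rate to a vanishing derivative\<close>

theorem theorem3p4:
  fixes \<phi> f :: "real \<Rightarrow> real"
  assumes "sampling_kernel \<phi>"
    and "\<And>u. has_discrete_moment \<phi> 0 u 1"
    and "\<And>u. has_discrete_moment \<phi> 1 u 0"
    and "f \<in> ub_continuous_deriv 2"
    and "(\<lambda>w. sup_norm (\<lambda>x. sampling_op \<phi> w f x - f x)) \<in> o[at_top](\<lambda>w. 1 / w)"
  shows "f constant_on UNIV"
proof -
  have C1: "\<forall>x. (deriv ^^ (1 - 1)) f field_differentiable at x" "(deriv ^^ 1) f \<in> ub_continuous"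
    and f: "f \<in> ub_continuous"
    using assms(4) unfolding ub_continuous_deriv_def by force+
  have df: "(f has_real_derivative deriv f x) (at x)" for x
    using C1(1) by (simp add: DERIV_deriv_iff_field_differentiable)
  obtain L where L: "\<And>x. \<bar>deriv f x\<bar> \<le> L"
    using C1(2) by (auto simp: ub_continuous_def bounded_iff)
  have lip: "\<bar>f s - f t\<bar> \<le> L * \<bar>s - t\<bar>" for s t
    using field_differentiable_bound[of UNIV f "deriv f" L s t] df L by simp
  have cont: "continuous_on UNIV f" and bdd: "bounded (range f)"
    using f by (auto simp: ub_continuous_def uniformly_continuous_imp_continuous)
  have zero: "deriv f x = 0" if x: "x \<noteq> 0" for x
  proof -
    \<comment> \<open>With this choice \<open>w n * x\<close> is \<open>Suc n\<close> up to the sign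
      of \<open>x\<close>; the successor keeps \<open>w n\<close> positive.\<close>
    define w where "w n = inverse \<bar>x\<bar> * real (Suc n)" for n
    have wp: "w n > 0" for n using x by (simp add: w_def)
    have wl: "filterlim w at_top sequentially"
      unfolding w_def using x
      by (intro filterlim_tendsto_pos_mult_at_top[OF tendsto_const]
          filterlim_compose[OF filterlim_real_sequentially filterlim_Suc]) simp
    have "w n * x = of_int (int (Suc n)) * sgn x" for n
      using x by (auto simp: w_def sgn_if)
    then have wi: "w n * x \<in> \<int>" for n
      by (auto simp: sgn_if)
    have lim: "(\<lambda>n. w n * (sampling_op \<phi> (w n) f x - f x)) \<longlonglongrightarrow> deriv f x / 2"
      by (rule sampling_op_voronovskaya[OF assms(2,3) cont lip df wp wl wi])
    have "((\<lambda>w. sup_norm (\<lambda>x. sampling_op \<phi> w f x - f x) / (1 / w)) \<longlongrightarrow> 0) at_top"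
      using assms(5) by (rule smalloD_tendsto)
    from filterlim_compose[OF this wl]
    have "(\<lambda>n. w n * sup_norm (\<lambda>x. sampling_op \<phi> (w n) f x - f x)) \<longlonglongrightarrow> 0"
      by (simp add: mult.commute)
    then have "(\<lambda>n. w n * (sampling_op \<phi> (w n) f x - f x)) \<longlonglongrightarrow> 0"
    proof (rule Lim_null_comparison[rotated], intro always_eventually allI)
      fix n
      \<comment> \<open>Boundedness is what lets the real-valued supremum dominate the error at the
        point \<open>x\<close>.\<close>
      have "bounded (range (\<lambda>x. sampling_op \<phi> (w n) f x - f x))"
        by (intro bounded_minus_comp bounded_sampling_op[OF assms(1) wp cont bdd] bdd)
      from abs_le_sup_norm[OF this, of x]
      show "norm (w n * (sampling_op \<phi> (w n) f x - f x))
          \<le> w n * sup_norm (\<lambda>x. sampling_op \<phi> (w n) f x - f x)"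
        using wp[of n] by (simp add: abs_mult)
    qed
    with lim show ?thesis
      using LIMSEQ_unique by fastforce
  qed
  have "(f has_derivative (\<lambda>h. 0)) (at x)" if "x \<noteq> 0" for x
    using df[of x] zero[OF that] by (simp add: has_field_derivative_def lambda_zero)
  then show ?thesis
    \<comment> \<open>The origin, where \<open>inverse \<bar>x\<bar>\<close> gives no sequence,
      enters as a finite exceptional set; continuity of \<open>f\<close> bridges it.\<close>
    using cont by (intro has_derivative_zero_connected_constant_on[where K = "{0}"]) auto
qed

end
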